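(* Let $k\ge 4$ and let $G$ be a mixed $k$-melon graph whose set of paths $\mathcal{P}=\mathcal{P}_{even}\cup\mathcal{P}_{odd}$ satisfies $|\mathcal{P}_{even}|\ge 2$ and $|\mathcal{P}_{odd}|\ge 2$. For $P_e\in\mathcal{P}_{even}$ and $\mathcal{S}_o\subseteq\mathcal{P}_{odd}$ let $U^{P_e}_{\mathcal{S}_o}$ be the vertex set such that $P_e$ is external, every path of $\mathcal{P}_{even}\setminus\{P_e\}$ is internal, every path of $\mathcal{S}_o$ is an $s$-path, and every path of $\mathcal{P}_{odd}\setminus\mathcal{S}_o$ is a $t$-path, all with respect to $U^{P_e}_{\mathcal{S}_o}$. Then $\mathrm{evc}(G)=\mathrm{vc}(G)+1$, and $\mathcal{U}=\{U^{P_e}_{\mathcal{S}_o} : P_e\in\mathcal{P}_{even},\ \emptyset\ne\mathcal{S}_o\subsetneq\mathcal{P}_{odd}\}$ is a minimum eternal vertex cover class of $G$.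
   Context: For $k\ge1$, a $k$-melon graph is the union of a set $\mathcal{P}$ of $k$ pairwise internally vertex-disjoint paths, each of length at least $1$, with the same two distinct endpoints $s$ and $t$. $\mathcal{P}_{even}$ and $\mathcal{P}_{odd}$ are the paths of even and odd length; $G$ is mixed if both are nonempty. For an even path $P$ with vertices $v_0,\dots,v_{2m}$, $\{v_0,v_{2m}\}=\{s,t\}$, and a vertex set $U$: $P$ is internal w.r.t. $U$ if $U\cap V(P)=\{v_{2j}:0\le j\le m\}$, external if $U\cap V(P)=\{v_{2j+1}:0\le j\le m-1\}\cup\{s,t\}$. For an odd path $P_o$ with vertices $v_0=t,\dots,v_{2m+1}=s$: $P_o$ is an $s$-path w.r.t. $U$ if $(U\cap V(P_o))\setminus\{t\}=\{v_{2i+1}:0\le i\le m\}$, a $t$-path if $(U\cap V(P_o))\setminus\{s\}=\{v_{2i}:0\le i\le m\}$. $\mathrm{vc}(G)$ is the vertex cover number. For a vertex cover $U$ of $G=(V,E)$ and an edge $e=vw$, a defense of $U$ against $e$ is a one-to-one map $\phi:U\to V$ with $\phi(u)\in N[u]$ (closed neighborhood) for all $u\in U$ and $\phi(v)=w$ (with $v\in U$) or $\phi(w)=v$ (with $w\in U$). An eternal vertex cover class is a family $\mathcal{U}$ of vertex covers of equal cardinality (its size) such that for every $U\in\mathcal{U}$ and every edge $e$ there is a defense $\phi$ of $U$ against $e$ with $\phi(U)\in\mathcal{U}$; $\mathrm{evc}(G)$ is the minimum size of such a class, and a class of that size is minimum. *)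

theory Defs
  imports Main
begin

record 'a ugraph =
  verts :: "'a set"
  edges :: "'a set set"

definition closed_nbhd :: "'a ugraph \<Rightarrow> 'a \<Rightarrow> 'a set" where
  "closed_nbhd G u = insert u {w \<in> verts G. {u, w} \<in> edges G}"

definition vertex_cover :: "'a ugraph \<Rightarrow> 'a set \<Rightarrow> bool" where
  "vertex_cover G U \<longleftrightarrow> U \<subseteq> verts G \<and> (\<forall>e\<in>edges G. e \<inter> U \<noteq> {})"

definition vc :: "'a ugraph \<Rightarrow> nat" where
  "vc G = (LEAST n. \<exists>U. vertex_cover G U \<and> card U = n)"

definition defense :: "'a ugraph \<Rightarrow> 'a set \<Rightarrow> 'a set \<Rightarrow> ('a \<Rightarrow> 'a) \<Rightarrow> bool" where
  "defense G U e \<phi> \<longleftrightarrow>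
     inj_on \<phi> U \<and> \<phi> ` U \<subseteq> verts G \<and>
     (\<forall>u\<in>U. \<phi> u \<in> closed_nbhd G u) \<and>
     (\<exists>v w. e = {v, w} \<and> v \<in> U \<and> \<phi> v = w)"

text \<open>The family is required to be nonempty: the empty family would vacuously be a class of
  every size.\<close>

definition eternal_vc_class :: "'a ugraph \<Rightarrow> nat \<Rightarrow> 'a set set \<Rightarrow> bool" where
  "eternal_vc_class G n \<U> \<longleftrightarrow>
     \<U> \<noteq> {} \<and>
     (\<forall>U\<in>\<U>. vertex_cover G U \<and> card U = n) \<and>
     (\<forall>U\<in>\<U>. \<forall>e\<in>edges G. \<exists>\<phi>. defense G U e \<phi> \<and> \<phi> ` U \<in> \<U>)"

definition evc :: "'a ugraph \<Rightarrow> nat" where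
  "evc G = (LEAST n. \<exists>\<U>. eternal_vc_class G n \<U>)"

definition minimum_eternal_vc_class :: "'a ugraph \<Rightarrow> 'a set set \<Rightarrow> bool" where
  "minimum_eternal_vc_class G \<U> \<longleftrightarrow> eternal_vc_class G (evc G) \<U>"

text \<open>A path between \<open>s\<close> and \<open>t\<close> is represented by the list of its vertices, read from \<open>s\<close> to
  \<open>t\<close>. For \<open>s \<noteq> t\<close> this list is unique, so distinct lists are distinct paths.\<close>

definition st_path :: "'a \<Rightarrow> 'a \<Rightarrow> 'a list \<Rightarrow> bool" where
  "st_path s t p \<longleftrightarrow> p \<noteq> [] \<and> distinct p \<and> hd p = s \<and> last p = t"

definition path_length :: "'a list \<Rightarrow> nat" where
  "path_length p = length p - 1"

definition path_edges :: "'a list \<Rightarrow> 'a set set" where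
  "path_edges p = {{p ! i, p ! Suc i} | i. Suc i < length p}"

definition melon_graph :: "nat \<Rightarrow> 'a ugraph \<Rightarrow> 'a \<Rightarrow> 'a \<Rightarrow> 'a list set \<Rightarrow> bool" where
  "melon_graph k G s t \<P> \<longleftrightarrow>
     k \<ge> 1 \<and> s \<noteq> t \<and> finite \<P> \<and> card \<P> = k \<and>
     (\<forall>p\<in>\<P>. st_path s t p \<and> path_length p \<ge> 1) \<and>
     (\<forall>p\<in>\<P>. \<forall>q\<in>\<P>. p \<noteq> q \<longrightarrow> (set p - {s, t}) \<inter> (set q - {s, t}) = {}) \<and>
     verts G = (\<Union>p\<in>\<P>. set p) \<and>
     edges G = (\<Union>p\<in>\<P>. path_edges p)"

definition even_paths :: "'a list set \<Rightarrow> 'a list set" where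
  "even_paths \<P> = {p \<in> \<P>. even (path_length p)}"

definition odd_paths :: "'a list set \<Rightarrow> 'a list set" where
  "odd_paths \<P> = {p \<in> \<P>. odd (path_length p)}"

definition mixed :: "'a list set \<Rightarrow> bool" where
  "mixed \<P> \<longleftrightarrow> even_paths \<P> \<noteq> {} \<and> odd_paths \<P> \<noteq> {}"

definition internal :: "'a set \<Rightarrow> 'a list \<Rightarrow> bool" where
  "internal U p \<longleftrightarrow>
     (\<exists>m. path_length p = 2 * m \<and> U \<inter> set p = {p ! (2 * j) | j. j \<le> m})"

definition external :: "'a \<Rightarrow> 'a \<Rightarrow> 'a set \<Rightarrow> 'a list \<Rightarrow> bool" where
  "external s t U p \<longleftrightarrow>
     (\<exists>m. path_length p = 2 * m \<and> U \<inter> set p = {p ! (2 * j + 1) | j. j < m} \<union> {s, t})"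

text \<open>Vertices of odd paths are numbered from \<open>t\<close> to \<open>s\<close>, hence the list is reversed.\<close>

definition s_path :: "'a \<Rightarrow> 'a set \<Rightarrow> 'a list \<Rightarrow> bool" where
  "s_path t U p \<longleftrightarrow>
     (\<exists>m. path_length p = 2 * m + 1 \<and> (U \<inter> set p) - {t} = {rev p ! (2 * i + 1) | i. i \<le> m})"

definition t_path :: "'a \<Rightarrow> 'a set \<Rightarrow> 'a list \<Rightarrow> bool" where
  "t_path s U p \<longleftrightarrow>
     (\<exists>m. path_length p = 2 * m + 1 \<and> (U \<inter> set p) - {s} = {rev p ! (2 * i) | i. i \<le> m})"

definition melon_config ::
  "'a ugraph \<Rightarrow> 'a \<Rightarrow> 'a \<Rightarrow> 'a list set \<Rightarrow> 'a list \<Rightarrow> 'a list set \<Rightarrow> 'a set \<Rightarrow> bool" where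
  "melon_config G s t \<P> P\<^sub>e S\<^sub>o U \<longleftrightarrow>
     U \<subseteq> verts G \<and>
     external s t U P\<^sub>e \<and>
     (\<forall>p \<in> even_paths \<P> - {P\<^sub>e}. internal U p) \<and>
     (\<forall>p \<in> S\<^sub>o. s_path t U p) \<and>
     (\<forall>p \<in> odd_paths \<P> - S\<^sub>o. t_path s U p)"

definition melon_set ::
  "'a ugraph \<Rightarrow> 'a \<Rightarrow> 'a \<Rightarrow> 'a list set \<Rightarrow> 'a list \<Rightarrow> 'a list set \<Rightarrow> 'a set" where
  "melon_set G s t \<P> P\<^sub>e S\<^sub>o = (THE U. melon_config G s t \<P> P\<^sub>e S\<^sub>o U)"

definition melon_class ::
  "'a ugraph \<Rightarrow> 'a \<Rightarrow> 'a \<Rightarrow> 'a list set \<Rightarrow> 'a set set" where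
  "melon_class G s t \<P> =
     {melon_set G s t \<P> P\<^sub>e S\<^sub>o | P\<^sub>e S\<^sub>o.
        P\<^sub>e \<in> even_paths \<P> \<and> S\<^sub>o \<noteq> {} \<and> S\<^sub>o \<subset> odd_paths \<P>}"

lemma melon_config_unique_existence:
  assumes "melon_graph k G s t \<P>" and "P\<^sub>e \<in> even_paths \<P>" and "S\<^sub>o \<subseteq> odd_paths \<P>"
  shows "\<exists>!U. melon_config G s t \<P> P\<^sub>e S\<^sub>o U"
proof -
  define m where "m p = path_length p div 2" for p :: "'a list"
  define A where "A p = (if p = P\<^sub>e then {p ! (2 * j + 1) | j. j < m p}
      else if even (path_length p) then {p ! (2 * j) | j. j \<le> m p}
      else if p \<in> S\<^sub>o then {rev p ! (2 * i + 1) | i. i \<le> m p}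
      else {rev p ! (2 * i) | i. i \<le> m p})" for p
  define F where "F p = A p \<union> {s, t}" for p
  define W where "W = (\<Union>p\<in>\<P>. F p)"
  have st: "s \<noteq> t" using assms(1) by (simp add: melon_graph_def)
  have path: "st_path s t p" "path_length p \<ge> 1" if "p \<in> \<P>" for p
    using assms(1) that by (auto simp: melon_graph_def)
  have disj: "set p \<inter> set q \<subseteq> {s, t}" if "p \<in> \<P>" "q \<in> \<P>" "p \<noteq> q" for p q
    using assms(1) that unfolding melon_graph_def by blast
  have V: "verts G = (\<Union>p\<in>\<P>. set p)" using assms(1) by (simp add: melon_graph_def)
  have Pe: "P\<^sub>e \<in> \<P>" "even (path_length P\<^sub>e)" using assms(2) by (auto simp: even_paths_def)
  have So: "p \<in> \<P>" "odd (path_length p)" if "p \<in> S\<^sub>o" for p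
    using assms(3) that by (auto simp: odd_paths_def)
  have len: "length p = Suc (path_length p)" if "p \<in> \<P>" for p
    using path(2)[OF that] by (simp add: path_length_def)
  have ends: "p ! 0 = s" "p ! path_length p = t" "rev p ! 0 = t" "rev p ! path_length p = s"
      "distinct p" "s \<in> set p" "t \<in> set p" if "p \<in> \<P>" for p
  proof -
    have *: "p \<noteq> []" "distinct p" "hd p = s" "last p = t"
      using path(1)[OF that] by (auto simp: st_path_def)
    show "p ! 0 = s" "p ! path_length p = t" "rev p ! 0 = t" "rev p ! path_length p = s"
      "distinct p" "s \<in> set p" "t \<in> set p"
      using * by (auto simp: hd_conv_nth last_conv_nth path_length_def rev_nth)
  qed
  have even_m: "path_length p = 2 * m p" if "even (path_length p)" for p :: "'a list"
    using that by (simp add: m_def)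
  have odd_m: "path_length p = 2 * m p + 1" if "odd (path_length p)" for p :: "'a list"
    using that by (simp add: m_def)
  have m_ev: "path_length p = 2 * n \<Longrightarrow> n = m p" and m_od: "path_length p = 2 * n + 1 \<Longrightarrow> n = m p"
    for p :: "'a list" and n by (auto simp: m_def)
  have Asub: "A p \<subseteq> set p" if "p \<in> \<P>" for p
  proof -
    have r: "rev p ! i \<in> set p" if "i < length p" for i
      using that by (metis length_rev nth_mem set_rev)
    have n: "p ! i \<in> set p" if "i < length p" for i using that by simp
    show ?thesis
    proof (cases "even (path_length p)")
      case True
      then have "A p \<subseteq> {p ! i | i. i < length p}"
        using So(2) len[OF that] even_m[OF True] by (fastforce simp: A_def split: if_splits)
      then show ?thesis using n by blast
    next
      case False
      then have "A p \<subseteq> {rev p ! i | i. i < length p}"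
        using Pe(2) len[OF that] odd_m[OF False] by (fastforce simp: A_def split: if_splits)
      then show ?thesis using r by blast
    qed
  qed
  have Fsub: "F p \<subseteq> set p" if "p \<in> \<P>" for p
    using Asub[OF that] ends(6,7)[OF that] by (auto simp: F_def)
  have WF: "W \<inter> set p = F p" if p: "p \<in> \<P>" for p
  proof
    show "F p \<subseteq> W \<inter> set p" using Fsub[OF p] p by (auto simp: W_def)
    show "W \<inter> set p \<subseteq> F p"
    proof
      fix x assume x: "x \<in> W \<inter> set p"
      then obtain q where q: "q \<in> \<P>" "x \<in> F q" by (auto simp: W_def)
      show "x \<in> F p"
      proof (cases "p = q")
        case False
        then have "x \<in> {s, t}" using disj[OF p q(1)] Fsub[OF q(1)] q(2) x by blast
        then show ?thesis by (auto simp: F_def)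
      qed (use q in simp)
    qed
  qed
  have Fint: "F p = {p ! (2 * j) | j. j \<le> m p}"
    if p: "p \<in> \<P>" "even (path_length p)" "p \<noteq> P\<^sub>e" for p
  proof -
    have "s \<in> {p ! (2 * j) | j. j \<le> m p}" using ends(1)[OF p(1)] by force
    moreover have "t \<in> {p ! (2 * j) | j. j \<le> m p}"
      using ends(2)[OF p(1)] even_m[OF p(2)] by force
    ultimately show ?thesis using p by (auto simp: F_def A_def)
  qed
  have Fs: "F p - {t} = {rev p ! (2 * i + 1) | i. i \<le> m p}" if p: "p \<in> S\<^sub>o" for p
  proof -
    note P = So[OF p]
    have "s \<in> {rev p ! (2 * i + 1) | i. i \<le> m p}"
      using ends(4)[OF P(1)] odd_m[OF P(2)] by force
    moreover have "rev p ! (2 * i + 1) \<noteq> t" if "i \<le> m p" for i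
    proof -
      have "rev p ! (2 * i + 1) \<noteq> rev p ! 0"
        using that len[OF P(1)] odd_m[OF P(2)] ends(5)[OF P(1)] by (subst nth_eq_iff_index_eq) auto
      then show ?thesis using ends(3)[OF P(1)] by simp
    qed
    moreover have "A p = {rev p ! (2 * i + 1) | i. i \<le> m p}"
      using p P Pe(2) by (auto simp: A_def)
    ultimately show ?thesis unfolding F_def by blast
  qed
  have Ft: "F p - {s} = {rev p ! (2 * i) | i. i \<le> m p}"
    if p: "p \<in> \<P>" "odd (path_length p)" "p \<notin> S\<^sub>o" for p
  proof -
    have "t \<in> {rev p ! (2 * i) | i. i \<le> m p}" using ends(3)[OF p(1)] by force
    moreover have "rev p ! (2 * i) \<noteq> s" if "i \<le> m p" for i
    proof -
      have "rev p ! (2 * i) \<noteq> rev p ! path_length p"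
        using that len[OF p(1)] odd_m[OF p(2)] ends(5)[OF p(1)] by (subst nth_eq_iff_index_eq) auto
      then show ?thesis using ends(4)[OF p(1)] by simp
    qed
    moreover have "A p = {rev p ! (2 * i) | i. i \<le> m p}"
      using p Pe(2) by (auto simp: A_def)
    ultimately show ?thesis unfolding F_def by blast
  qed
  have FPe: "F P\<^sub>e = {P\<^sub>e ! (2 * j + 1) | j. j < m P\<^sub>e} \<union> {s, t}"
    by (simp add: F_def A_def)
  show ?thesis
  proof (rule ex1I)
    show "melon_config G s t \<P> P\<^sub>e S\<^sub>o W"
      unfolding melon_config_def
    proof (intro conjI ballI)
      show "W \<subseteq> verts G" using Fsub V by (auto simp: W_def)
      show "external s t W P\<^sub>e"
        unfolding external_def using FPe WF[OF Pe(1)] even_m[OF Pe(2)] by blast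
    next
      fix p assume "p \<in> even_paths \<P> - {P\<^sub>e}"
      then have p: "p \<in> \<P>" "even (path_length p)" "p \<noteq> P\<^sub>e" by (auto simp: even_paths_def)
      show "internal W p"
        unfolding internal_def using Fint[OF p] WF[OF p(1)] even_m[OF p(2)] by blast
    next
      fix p assume p: "p \<in> S\<^sub>o"
      show "s_path t W p"
        unfolding s_path_def WF[OF So(1)[OF p]] using Fs[OF p] odd_m[OF So(2)[OF p]] by blast
    next
      fix p assume "p \<in> odd_paths \<P> - S\<^sub>o"
      then have p: "p \<in> \<P>" "odd (path_length p)" "p \<notin> S\<^sub>o" by (auto simp: odd_paths_def)
      show "t_path s W p"
        unfolding t_path_def WF[OF p(1)] using Ft[OF p] odd_m[OF p(2)] by blast
    qed
  next
    fix U assume U: "melon_config G s t \<P> P\<^sub>e S\<^sub>o U"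
    have UPe: "U \<inter> set P\<^sub>e = F P\<^sub>e"
      using U m_ev unfolding melon_config_def external_def FPe by blast
    then have stU: "s \<in> U" "t \<in> U" by (auto simp: F_def)
    have "U \<inter> set p = F p" if p: "p \<in> \<P>" for p
    proof -
      consider "p = P\<^sub>e" | "even (path_length p)" "p \<noteq> P\<^sub>e" | "p \<in> S\<^sub>o"
        | "odd (path_length p)" "p \<notin> S\<^sub>o" by blast
      then show ?thesis
      proof cases
        case 1 then show ?thesis using UPe by simp
      next
        case 2
        then have "internal U p" using U p by (auto simp: melon_config_def even_paths_def)
        then show ?thesis unfolding internal_def Fint[OF p 2] using m_ev by blast
      next
        case 3
        then have "s_path t U p" using U by (auto simp: melon_config_def)
        then have "U \<inter> set p - {t} = F p - {t}" unfolding s_path_def Fs[OF 3] using m_od by blast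
        moreover have "t \<in> U \<inter> set p" "t \<in> F p" using stU ends(7)[OF p] by (auto simp: F_def)
        ultimately show ?thesis by blast
      next
        case 4
        then have "t_path s U p" using U p by (auto simp: melon_config_def odd_paths_def)
        then have "U \<inter> set p - {s} = F p - {s}" unfolding t_path_def Ft[OF p 4] using m_od by blast
        moreover have "s \<in> U \<inter> set p" "s \<in> F p" using stU ends(6)[OF p] by (auto simp: F_def)
        ultimately show ?thesis by blast
      qed
    qed
    then have "U \<inter> set p = W \<inter> set p" if "p \<in> \<P>" for p using WF that by simp
    moreover have "U \<subseteq> verts G" using U by (simp add: melon_config_def)
    moreover have "W \<subseteq> verts G" using Fsub V by (auto simp: W_def)
    ultimately show "U = W" unfolding V by blast
  qed
qed

end

theory Submission
  imports Defs
begin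

text \<open>A configuration of the class contains \<open>s\<close> and \<open>t\<close>, and on each path it occupies the interior
  vertices whose index, counted from \<open>s\<close>, has a fixed parity. An attack is answered on two paths
  of equal length parity, one occupied at odd and one at even indices: every guard of the first
  moves one step in one direction while every guard of the second moves one step in the other,
  which exchanges the two occupation patterns and keeps \<open>s\<close> and \<open>t\<close> guarded. An attacked edge joins
  an even to an odd index, so one of the two directions defends it. Since there are at
  least two even paths, exactly one of them external, and both \<open>s\<close>-paths and \<open>t\<close>-paths occur, the
  attacked path always has a partner.

  For the lower bound, counting along matchings shows that a minimum vertex cover never contains
  the neighbour of \<open>s\<close> on an even path; attacking the edge between \<open>s\<close> and that neighbour
  therefore forces one guard more.\<close>

section \<open>Counting indices by blocks and by parity\<close>

text \<open>The window splits into \<open>k\<close> disjoint pairs of consecutive indices, each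
  containing at least one index that satisfies \<open>Q\<close>. Read along a path, this is the
  matching bound for vertex covers.\<close>

lemma card_alternate_cover:
  fixes k :: nat
  assumes "\<And>i. a \<le> i \<Longrightarrow> Suc i < a + 2 * k \<Longrightarrow> Q i \<or> Q (Suc i)"
  shows "k \<le> card {i \<in> {a..<a + 2 * k}. Q i}"
  using assms
proof (induction k)
  case (Suc k)
  let ?S = "\<lambda>k. {i \<in> {a..<a + 2 * k}. Q i}"
  have "k \<le> card (?S k)" using Suc by auto
  moreover obtain j where j: "j = a + 2 * k \<or> j = Suc (a + 2 * k)" "Q j"
    using Suc.prems[of "a + 2 * k"] by auto
  have "card (insert j (?S k)) \<le> card (?S (Suc k))"
    using j by (intro card_mono) auto
  moreover have "card (insert j (?S k)) = Suc (card (?S k))"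
    using j by (subst card_insert_disjoint) auto
  ultimately show ?case by linarith
qed simp

lemma card_odd_below: "card {i. 0 < i \<and> i < n \<and> odd i} = n div 2"
proof -
  have "{i. 0 < i \<and> i < n \<and> odd i} = (\<lambda>j. 2 * j + 1) ` {..<n div 2}"
    by (auto elim!: oddE simp: image_iff)
  then show ?thesis by (simp add: card_image inj_on_def)
qed

text \<open>Index \<open>0\<close> is excluded as an end of the path, so for even positive
  \<open>n\<close> there is one even index fewer than odd ones, while for odd \<open>n\<close> the
  two counts agree.\<close>

lemma card_even_below: "card {i. 0 < i \<and> i < n \<and> even i} = (n - 1) div 2"
proof -
  have "{i. 0 < i \<and> i < n \<and> even i} = (\<lambda>j. 2 * j + 2) ` {..<(n - 1) div 2}"
  proof (intro equalityI subsetI)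
    fix i assume "i \<in> {i. 0 < i \<and> i < n \<and> even i}"
    then have "i = 2 * (i div 2 - 1) + 2" "i div 2 - 1 < (n - 1) div 2" by (auto elim!: evenE)
    then show "i \<in> (\<lambda>j. 2 * j + 2) ` {..<(n - 1) div 2}" by blast
  qed auto
  then show ?thesis by (simp add: card_image inj_on_def)
qed

section \<open>Path indices, vertices and edges of a melon graph\<close>

locale melon =
  fixes k :: nat and G :: "'a ugraph" and s t :: 'a and \<P> :: "'a list set"
  assumes melon: "melon_graph k G s t \<P>"
begin

lemma s_neq_t: "s \<noteq> t"
  and finite_paths: "finite \<P>"
  and verts_eq: "verts G = (\<Union>p\<in>\<P>. set p)"
  and edges_eq: "edges G = (\<Union>p\<in>\<P>. path_edges p)"
  using melon by (auto simp: melon_graph_def)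

lemma paths_meet_at_ends:
  "p \<in> \<P> \<Longrightarrow> q \<in> \<P> \<Longrightarrow> p \<noteq> q \<Longrightarrow> x \<in> set p \<Longrightarrow> x \<in> set q \<Longrightarrow> x = s \<or> x = t"
  using melon unfolding melon_graph_def by blast

context
  fixes p assumes p: "p \<in> \<P>"
begin

lemma length_path: "length p = Suc (path_length p)"
  and path_length_pos: "0 < path_length p"
  and distinct_path: "distinct p"
  using melon p by (auto simp: melon_graph_def path_length_def st_path_def)

lemma nth_path_first: "p ! 0 = s"
  and nth_path_last: "p ! path_length p = t"
  using melon p
  by (auto simp: melon_graph_def path_length_def st_path_def hd_conv_nth last_conv_nth)

lemma nth_path_inj:
  "i \<le> path_length p \<Longrightarrow> j \<le> path_length p \<Longrightarrow> p ! i = p ! j \<longleftrightarrow> i = j"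
  using distinct_path length_path by (simp add: nth_eq_iff_index_eq)

lemma nth_path_eq_s: "i \<le> path_length p \<Longrightarrow> p ! i = s \<longleftrightarrow> i = 0"
  using nth_path_inj[of i 0] nth_path_first by simp

lemma nth_path_eq_t: "i \<le> path_length p \<Longrightarrow> p ! i = t \<longleftrightarrow> i = path_length p"
  using nth_path_inj[of i "path_length p"] nth_path_last by simp

lemma nth_in_path: "i \<le> path_length p \<Longrightarrow> p ! i \<in> set p"
  using length_path by simp

lemma nth_in_verts: "i \<le> path_length p \<Longrightarrow> p ! i \<in> verts G"
  using nth_in_path p verts_eq by blast

lemma in_path_iff: "x \<in> set p \<longleftrightarrow> (\<exists>i \<le> path_length p. x = p ! i)"
  using length_path by (auto simp: in_set_conv_nth less_Suc_eq_le)

lemma edge_in_graph: "i < path_length p \<Longrightarrow> {p ! i, p ! Suc i} \<in> edges G"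
  using p length_path by (force simp: edges_eq path_edges_def)

end

text \<open>An interior vertex differs from \<open>s\<close> and \<open>t\<close>, the only vertices
  that distinct paths share. One interior index is enough, so \<open>j\<close> may be an end of
  \<open>q\<close>.\<close>

lemma nth_paths_eq:
  assumes "p \<in> \<P>" "q \<in> \<P>" "0 < i" "i < path_length p" "j \<le> path_length q" "p ! i = q ! j"
  shows "p = q \<and> i = j"
proof -
  have "p ! i \<noteq> s" "p ! i \<noteq> t"
    using assms nth_path_eq_s[of p i] nth_path_eq_t[of p i] by auto
  then have "p = q"
    using paths_meet_at_ends[of p q "p ! i"] nth_in_path assms by (metis less_imp_le)
  then show ?thesis using nth_path_inj[of p i j] assms by auto
qed

lemma edge_cases:
  assumes "e \<in> edges G"
  obtains p i where "p \<in> \<P>" "i < path_length p" "e = {p ! i, p ! Suc i}"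
  using assms length_path by (auto simp: edges_eq path_edges_def)

lemma finite_verts: "finite (verts G)"
  using finite_paths verts_eq by simp

definition inner_indices :: "'a set \<Rightarrow> 'a list \<Rightarrow> nat set" where
  "inner_indices W p = {i. 0 < i \<and> i < path_length p \<and> p ! i \<in> W}"

lemma finite_inner_indices [simp]: "finite (inner_indices W p)"
  by (rule finite_subset[of _ "{..<path_length p}"]) (auto simp: inner_indices_def)

text \<open>A vertex other than \<open>s\<close> and \<open>t\<close> corresponds to exactly one
  pair of a path and an interior index. Cardinalities can therefore be computed path by
  path.\<close>

lemma card_eq_sum_inner_indices:
  assumes "W \<subseteq> verts G"
  shows "card W = card (W \<inter> {s, t}) + (\<Sum>p\<in>\<P>. card (inner_indices W p))"
proof -
  let ?I = "Sigma \<P> (inner_indices W)" and ?f = "\<lambda>(p, i). p ! i"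
  have inner: "p ! i \<noteq> s" "p ! i \<noteq> t" "p ! i \<in> W" if "p \<in> \<P>" "i \<in> inner_indices W p" for p i
    using that nth_path_eq_s[of p i] nth_path_eq_t[of p i] by (auto simp: inner_indices_def)
  have "W \<subseteq> (W \<inter> {s, t}) \<union> ?f ` ?I"
  proof
    fix x assume x: "x \<in> W"
    then obtain p where p: "p \<in> \<P>" "x \<in> set p" using assms verts_eq by auto
    then obtain i where i: "i \<le> path_length p" "x = p ! i" using in_path_iff by blast
    show "x \<in> (W \<inter> {s, t}) \<union> ?f ` ?I"
    proof (cases "x = s \<or> x = t")
      case False
      then have "i \<noteq> 0" "i \<noteq> path_length p"
        using i nth_path_first[OF p(1)] nth_path_last[OF p(1)] by metis+
      then have "(p, i) \<in> ?I" using i p x by (auto simp: inner_indices_def)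
      then show ?thesis using i by force
    qed (use x in auto)
  qed
  moreover have "(W \<inter> {s, t}) \<union> ?f ` ?I \<subseteq> W" using inner by auto
  ultimately have "W = (W \<inter> {s, t}) \<union> ?f ` ?I" by (rule equalityI)
  moreover have "(W \<inter> {s, t}) \<inter> ?f ` ?I = {}" using inner by auto
  moreover have fin: "finite ?I" using finite_paths by auto
  ultimately have "card W = card (W \<inter> {s, t}) + card (?f ` ?I)"
    using card_Un_disjoint[of "W \<inter> {s, t}" "?f ` ?I"] by simp
  moreover have "inj_on ?f ?I"
  proof (rule inj_onI)
    fix x y assume "x \<in> ?I" "y \<in> ?I" "?f x = ?f y"
    then show "x = y"
      using nth_paths_eq[of "fst x" "fst y" "snd x" "snd y"]
      by (cases x, cases y) (simp add: inner_indices_def)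
  qed
  ultimately have "card W = card (W \<inter> {s, t}) + card ?I" by (simp add: card_image)
  then show ?thesis by (simp add: finite_paths)
qed

text \<open>Reference value for all counts. With both ends occupied, an even path of length
  \<open>2 * m\<close> needs \<open>m - 1\<close> interior vertices and an odd one of length
  \<open>2 * m + 1\<close> needs \<open>m\<close>. The number of even paths is added on the other
  side of later statements, which avoids subtraction of naturals.\<close>

abbreviation half_sum :: nat where
  "half_sum \<equiv> \<Sum>p\<in>\<P>. path_length p div 2"

lemma sum_split: "(\<Sum>p\<in>\<P>. f p) = (\<Sum>p\<in>even_paths \<P>. f p) + (\<Sum>p\<in>odd_paths \<P>. f p)"
  for f :: "'a list \<Rightarrow> nat"
proof -
  have "\<P> = even_paths \<P> \<union> odd_paths \<P>" "even_paths \<P> \<inter> odd_paths \<P> = {}"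
    by (auto simp: even_paths_def odd_paths_def)
  then show ?thesis using finite_paths by (metis finite_Un sum.union_disjoint)
qed

lemma finite_even: "finite (even_paths \<P>)" and finite_odd: "finite (odd_paths \<P>)"
  using finite_paths by (auto simp: even_paths_def odd_paths_def)

subsection \<open>Counting in vertex covers\<close>

context
  fixes W assumes W: "vertex_cover G W"
begin

lemma cover_edge: "p \<in> \<P> \<Longrightarrow> i < path_length p \<Longrightarrow> p ! i \<in> W \<or> p ! Suc i \<in> W"
  using W edge_in_graph[of p i] by (auto simp: vertex_cover_def)

lemma cover_block:
  assumes "p \<in> \<P>" "a + 2 * n \<le> Suc (path_length p)"
  shows "n \<le> card {i \<in> {a..<a + 2 * n}. p ! i \<in> W}"
  using assms by (intro card_alternate_cover cover_edge) auto

text \<open>The interior indices \<open>1\<close> to \<open>2 * m - 2\<close> carry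
  \<open>m - 1\<close> disjoint edges; the last interior vertex is left over.\<close>

lemma card_inner_even:
  assumes "p \<in> even_paths \<P>"
  shows "path_length p div 2 \<le> card (inner_indices W p) + 1"
proof -
  obtain m where m: "path_length p = 2 * m" and p: "p \<in> \<P>"
    using assms by (auto simp: even_paths_def)
  have "m - 1 \<le> card {i \<in> {1..<1 + 2 * (m - 1)}. p ! i \<in> W}"
    using m p by (intro cover_block) auto
  also have "\<dots> \<le> card (inner_indices W p)"
    using m by (intro card_mono) (auto simp: inner_indices_def)
  finally show ?thesis using m by simp
qed

text \<open>The interior has an odd number of vertices. If the first or the last of them is
  occupied, the others still split into \<open>m - 1\<close> disjoint edges, so \<open>m\<close>
  guards are needed.\<close>

lemma card_inner_even_strict:
  assumes "p \<in> even_paths \<P>" and "p ! 1 \<in> W \<or> s \<notin> W \<or> t \<notin> W"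
  shows "path_length p div 2 \<le> card (inner_indices W p)"
proof -
  obtain m where m: "path_length p = 2 * m" and p: "p \<in> \<P>"
    using assms by (auto simp: even_paths_def)
  have "m > 0" using path_length_pos[OF p] m by simp
  then obtain n where n: "m = Suc n" by (cases m) auto
  \<comment> \<open>A missing \<open>s\<close> forces its neighbour \<open>p ! 1\<close> into the
    cover, a missing \<open>t\<close> forces \<open>p ! (2 * n + 1)\<close>.\<close>
  have "p ! 1 \<in> W \<or> p ! (2 * n + 1) \<in> W"
    using cover_edge[OF p, of 0] cover_edge[OF p, of "2 * n + 1"] assms(2) m n
      nth_path_first[OF p] nth_path_last[OF p] by auto
  \<comment> \<open>\<open>j\<close> is the occupied extreme interior index, and the block of length
    \<open>2 * n\<close> starting at \<open>a\<close> consists of the remaining interior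
    indices.\<close>
  then obtain a j :: nat where aj: "a = 2 \<and> j = 1 \<or> a = 1 \<and> j = 2 * n + 1" "p ! j \<in> W" by blast
  let ?B = "{i \<in> {a..<a + 2 * n}. p ! i \<in> W}"
  have "n \<le> card ?B" using m n p aj by (intro cover_block) auto
  moreover have "card (insert j ?B) = Suc (card ?B)"
    using aj by (subst card_insert_disjoint) auto
  moreover have "card (insert j ?B) \<le> card (inner_indices W p)"
    using aj m n by (intro card_mono) (auto simp: inner_indices_def)
  ultimately show ?thesis using m n by simp
qed

lemma card_inner_odd:
  assumes "p \<in> odd_paths \<P>"
  shows "path_length p div 2 \<le> card (inner_indices W p)"
proof -
  obtain m where m: "path_length p = 2 * m + 1" and p: "p \<in> \<P>"
    using assms by (auto simp: odd_paths_def elim!: oddE)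
  have "m \<le> card {i \<in> {1..<1 + 2 * m}. p ! i \<in> W}"
    using m p by (intro cover_block) auto
  also have "\<dots> \<le> card (inner_indices W p)"
    using m by (intro card_mono) (auto simp: inner_indices_def)
  finally show ?thesis using m by simp
qed

text \<open>Both extreme interior vertices are forced, and the \<open>2 * n\<close> vertices between
  them need \<open>n\<close> more, giving \<open>n + 2\<close> against the half length
  \<open>n + 1\<close>. Length 1 is impossible, since the edge between \<open>s\<close> and
  \<open>t\<close> would be uncovered.\<close>

lemma card_inner_odd_strict:
  assumes "p \<in> odd_paths \<P>" and "s \<notin> W" "t \<notin> W"
  shows "path_length p div 2 < card (inner_indices W p)"
proof -
  obtain m where m: "path_length p = 2 * m + 1" and p: "p \<in> \<P>"
    using assms by (auto simp: odd_paths_def elim!: oddE)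
  have "m \<noteq> 0"
    using cover_edge[OF p, of 0] assms(2,3) m nth_path_first[OF p] nth_path_last[OF p]
    by (cases "m = 0") auto
  then obtain n where n: "m = Suc n" by (cases m) auto
  have ends: "p ! 1 \<in> W" "p ! (2 * n + 2) \<in> W"
    using cover_edge[OF p, of 0] cover_edge[OF p, of "2 * n + 2"] assms(2,3) m n
      nth_path_first[OF p] nth_path_last[OF p] by (auto simp: numeral_eq_Suc)
  let ?B = "{i \<in> {2..<2 + 2 * n}. p ! i \<in> W}"
  have "n \<le> card ?B" using m n p by (intro cover_block) auto
  moreover have "card (insert 1 (insert (2 * n + 2) ?B)) = Suc (Suc (card ?B))"
    by (simp add: card_insert_if)
  moreover have "card (insert 1 (insert (2 * n + 2) ?B)) \<le> card (inner_indices W p)"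
    using ends m n by (intro card_mono) (auto simp: inner_indices_def)
  ultimately show ?thesis using m n by simp
qed

text \<open>Omitting one end saves one guard but costs an extra guard on each of at least two even
  paths. Omitting both saves two, but then every odd path costs an extra guard as well, and there is
  at least one. Either way the total exceeds the minimum.\<close>

lemma cover_card_without_end:
  assumes "card (even_paths \<P>) \<ge> 2" "odd_paths \<P> \<noteq> {}" and "s \<notin> W \<or> t \<notin> W"
  shows "half_sum + 3 \<le> card W + card (even_paths \<P>)"
proof -
  let ?x = "\<lambda>p. card (inner_indices W p)"
  have W': "W \<subseteq> verts G" using W by (simp add: vertex_cover_def)
  have ev: "(\<Sum>p\<in>even_paths \<P>. path_length p div 2) \<le> (\<Sum>p\<in>even_paths \<P>. ?x p)"
    using assms(3) by (intro sum_mono card_inner_even_strict) auto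
  show ?thesis
  proof (cases "s \<in> W \<or> t \<in> W")
    case True
    have "(\<Sum>p\<in>odd_paths \<P>. path_length p div 2) \<le> (\<Sum>p\<in>odd_paths \<P>. ?x p)"
      by (intro sum_mono card_inner_odd)
    moreover have "card (W \<inter> {s, t}) = 1"
      using True assms(3) by (auto simp: Int_insert_right)
    ultimately show ?thesis
      using ev assms(1) card_eq_sum_inner_indices[OF W'] by (simp add: sum_split)
  next
    case False
    then have "(\<Sum>p\<in>odd_paths \<P>. path_length p div 2) < (\<Sum>p\<in>odd_paths \<P>. ?x p)"
      using assms(2) finite_odd by (intro sum_strict_mono card_inner_odd_strict) auto
    then show ?thesis
      using ev assms(1) card_eq_sum_inner_indices[OF W'] by (simp add: sum_split)
  qed
qed

text \<open>Every even path with \<open>p ! 1\<close> occupied contributes one guard above the bound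
  of \<open>card_inner_even\<close>; these surpluses add up.\<close>

lemma cover_card_with_ends:
  assumes "s \<in> W" "t \<in> W"
  shows "half_sum + 2 + card {p \<in> even_paths \<P>. p ! 1 \<in> W} \<le> card W + card (even_paths \<P>)"
proof -
  let ?x = "\<lambda>p. card (inner_indices W p)" and ?A = "{p \<in> even_paths \<P>. p ! 1 \<in> W}"
  have W': "W \<subseteq> verts G" using W by (simp add: vertex_cover_def)
  have "(\<Sum>p\<in>even_paths \<P>. path_length p div 2 + (if p ! 1 \<in> W then 1 else 0))
      \<le> (\<Sum>p\<in>even_paths \<P>. ?x p + 1)"
  proof (rule sum_mono)
    fix p assume "p \<in> even_paths \<P>"
    then show "path_length p div 2 + (if p ! 1 \<in> W then 1 else 0) \<le> ?x p + 1"
      using card_inner_even[of p] card_inner_even_strict[of p] by simp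
  qed
  moreover have "(\<Sum>p\<in>even_paths \<P>. if p ! 1 \<in> W then 1 else 0) = card ?A"
    using finite_even by (simp add: sum.If_cases Int_def)
  ultimately have ev: "(\<Sum>p\<in>even_paths \<P>. path_length p div 2) + card ?A
      \<le> (\<Sum>p\<in>even_paths \<P>. ?x p) + card (even_paths \<P>)"
    by (simp add: sum.distrib sum_Suc)
  have "(\<Sum>p\<in>odd_paths \<P>. path_length p div 2) \<le> (\<Sum>p\<in>odd_paths \<P>. ?x p)"
    by (intro sum_mono card_inner_odd)
  moreover have "card (W \<inter> {s, t}) = 2"
    using assms s_neq_t by (simp add: Int_insert_right)
  ultimately show ?thesis
    using ev card_eq_sum_inner_indices[OF W'] by (simp add: sum_split)
qed

lemma cover_card_lower:
  assumes "card (even_paths \<P>) \<ge> 2" "odd_paths \<P> \<noteq> {}"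
  shows "half_sum + 2 \<le> card W + card (even_paths \<P>)"
proof (cases "s \<in> W \<and> t \<in> W")
  case True
  then have "half_sum + 2 + card {p \<in> even_paths \<P>. p ! 1 \<in> W} \<le> card W + card (even_paths \<P>)"
    using cover_card_with_ends by blast
  then show ?thesis by linarith
next
  case False
  then have "half_sum + 3 \<le> card W + card (even_paths \<P>)"
    using cover_card_without_end[OF assms] by blast
  then show ?thesis by linarith
qed

text \<open>Either an end is missing, which already costs one more guard, or \<open>p\<close> itself
  contributes a surplus in \<open>cover_card_with_ends\<close>.\<close>

lemma cover_card_lower_strict:
  assumes "card (even_paths \<P>) \<ge> 2" "odd_paths \<P> \<noteq> {}"
    and "p \<in> even_paths \<P>" "p ! 1 \<in> W"
  shows "half_sum + 3 \<le> card W + card (even_paths \<P>)"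
proof (cases "s \<in> W \<and> t \<in> W")
  case True
  have "card {p \<in> even_paths \<P>. p ! 1 \<in> W} > 0"
    using assms(3,4) finite_even by (auto simp: card_gt_0_iff)
  moreover have "half_sum + 2 + card {p \<in> even_paths \<P>. p ! 1 \<in> W} \<le> card W + card (even_paths \<P>)"
    using cover_card_with_ends True by blast
  ultimately show ?thesis by linarith
qed (use cover_card_without_end[OF assms(1,2)] in blast)

end

subsection \<open>Alternating covers\<close>

text \<open>The set \<open>C\<close> collects the paths whose odd-indexed vertices, counted from \<open>s\<close>, are occupied:
  the external even path and the \<open>t\<close>-paths.\<close>

definition alt_cover :: "'a list set \<Rightarrow> 'a set" where
  "alt_cover C = {s, t} \<union> {p ! i | p i. p \<in> \<P> \<and> 0 < i \<and> i < path_length p \<and> (odd i \<longleftrightarrow> p \<in> C)}"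

lemma alt_cover_cases:
  assumes "x \<in> alt_cover C"
  obtains "x = s" | "x = t"
    | r i where "r \<in> \<P>" "0 < i" "i < path_length r" "odd i \<longleftrightarrow> r \<in> C" "x = r ! i"
  using assms unfolding alt_cover_def by (elim UnE insertE CollectE exE conjE) blast+

text \<open>Since an interior vertex has only one path and one index, the existential in
  \<open>alt_cover_def\<close> can only be witnessed by \<open>p\<close> and \<open>i\<close>
  themselves.\<close>

lemma alt_cover_nth:
  assumes "p \<in> \<P>" "i \<le> path_length p"
  shows "p ! i \<in> alt_cover C \<longleftrightarrow> i = 0 \<or> i = path_length p \<or> (odd i \<longleftrightarrow> p \<in> C)"
proof (cases "i = 0 \<or> i = path_length p")
  case True
  then show ?thesis using nth_path_first[OF assms(1)] nth_path_last[OF assms(1)] by (auto simp: alt_cover_def)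
next
  case False
  then have "p ! i \<noteq> s" "p ! i \<noteq> t" using nth_path_eq_s[of p i] nth_path_eq_t[of p i] assms by auto
  then have "p ! i \<in> alt_cover C \<longleftrightarrow>
      (\<exists>q j. p ! i = q ! j \<and> q \<in> \<P> \<and> 0 < j \<and> j < path_length q \<and> (odd j \<longleftrightarrow> q \<in> C))"
    by (auto simp: alt_cover_def)
  also have "\<dots> \<longleftrightarrow> (odd i \<longleftrightarrow> p \<in> C)" (is "?L \<longleftrightarrow> _")
  proof
    assume ?L
    then obtain q j where q: "p ! i = q ! j" "q \<in> \<P>" "j < path_length q" "odd j \<longleftrightarrow> q \<in> C"
      by blast
    then have "p = q \<and> i = j" using nth_paths_eq[of p q i j] assms False by simp
    then show "odd i \<longleftrightarrow> p \<in> C" using q(4) by simp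
  next
    assume "odd i \<longleftrightarrow> p \<in> C"
    then show ?L using assms False by (metis le_neq_implies_less not_gr_zero)
  qed
  finally show ?thesis using False by simp
qed

lemma paths_nonempty: "\<P> \<noteq> {}"
  using melon by (auto simp: melon_graph_def)

lemma ends_in_verts: "s \<in> verts G" "t \<in> verts G"
proof -
  obtain p where p: "p \<in> \<P>" using paths_nonempty by blast
  show "s \<in> verts G" "t \<in> verts G"
    using nth_in_verts[OF p, of 0] nth_in_verts[OF p order_refl]
      nth_path_first[OF p] nth_path_last[OF p] by auto
qed

lemma alt_cover_subset: "alt_cover C \<subseteq> verts G"
  using ends_in_verts nth_in_verts by (auto simp: alt_cover_def)

lemma vertex_cover_alt_cover: "vertex_cover G (alt_cover C)"
  unfolding vertex_cover_def
proof (intro conjI ballI alt_cover_subset)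
  fix e assume "e \<in> edges G"
  then obtain p i where e: "p \<in> \<P>" "i < path_length p" "e = {p ! i, p ! Suc i}"
    by (rule edge_cases)
  \<comment> \<open>Consecutive indices have opposite parity, so one of them is of the occupied
    parity; if that index is an end, it is occupied anyway.\<close>
  then show "e \<inter> alt_cover C \<noteq> {}" using alt_cover_nth[of p] by auto
qed

text \<open>On an odd path both parities have equally many interior indices, on an even path the odd
  ones are one more. Hence the size depends on \<open>C\<close> only through the number of even
  paths in it.\<close>

lemma card_alt_cover:
  "card (alt_cover C) + card (even_paths \<P>) = half_sum + 2 + card (even_paths \<P> \<inter> C)"
proof -
  let ?x = "\<lambda>p. card (inner_indices (alt_cover C) p)"
  have I: "inner_indices (alt_cover C) p = {i. 0 < i \<and> i < path_length p \<and> (odd i \<longleftrightarrow> p \<in> C)}"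
    if "p \<in> \<P>" for p
    using that alt_cover_nth[of p] by (auto simp: inner_indices_def)
  have x: "?x p = (if p \<in> C then path_length p div 2 else (path_length p - 1) div 2)"
    if "p \<in> \<P>" for p
    using I[OF that] by (simp add: card_odd_below card_even_below)
  have "(\<Sum>p\<in>even_paths \<P>. ?x p + 1)
      = (\<Sum>p\<in>even_paths \<P>. path_length p div 2 + (if p \<in> C then 1 else 0))"
  proof (rule sum.cong[OF refl])
    fix p assume "p \<in> even_paths \<P>"
    then have "p \<in> \<P>" "even (path_length p)" by (auto simp: even_paths_def)
    then show "?x p + 1 = path_length p div 2 + (if p \<in> C then 1 else 0)"
      using path_length_pos[of p] by (auto simp: x elim!: evenE)
  qed
  moreover have "(\<Sum>p\<in>even_paths \<P>. if p \<in> C then 1 else 0) = card (even_paths \<P> \<inter> C)"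
    using finite_even by (simp add: sum.If_cases)
  ultimately have ev: "(\<Sum>p\<in>even_paths \<P>. ?x p) + card (even_paths \<P>)
      = (\<Sum>p\<in>even_paths \<P>. path_length p div 2) + card (even_paths \<P> \<inter> C)"
    by (simp add: sum.distrib sum_Suc)
  have "(\<Sum>p\<in>odd_paths \<P>. ?x p) = (\<Sum>p\<in>odd_paths \<P>. path_length p div 2)"
    by (rule sum.cong) (auto simp: x odd_paths_def elim!: oddE)
  moreover have "card (alt_cover C \<inter> {s, t}) = 2"
    using s_neq_t by (simp add: alt_cover_def Int_insert_right)
  ultimately show ?thesis
    using ev card_eq_sum_inner_indices[OF alt_cover_subset, of C] by (simp add: sum_split)
qed

text \<open>On a path of odd length, reading from the other end swaps the parities. The odd
  positions of an \<open>s\<close>-path, counted from \<open>t\<close>, are thus even positions from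
  \<open>s\<close>, which puts \<open>s\<close>-paths outside \<open>C\<close> and
  \<open>t\<close>-paths inside.\<close>

lemma melon_set_eq_alt_cover:
  assumes "P\<^sub>e \<in> even_paths \<P>" "S\<^sub>o \<subseteq> odd_paths \<P>"
  shows "melon_set G s t \<P> P\<^sub>e S\<^sub>o = alt_cover (insert P\<^sub>e (odd_paths \<P> - S\<^sub>o))"
proof -
  let ?C = "insert P\<^sub>e (odd_paths \<P> - S\<^sub>o)"
  let ?U = "alt_cover ?C"
  have U: "?U \<inter> set p = {p ! i | i. i \<le> path_length p \<and>
      (i = 0 \<or> i = path_length p \<or> (odd i \<longleftrightarrow> p \<in> ?C))}" if "p \<in> \<P>" for p
  proof (rule set_eqI)
    fix x
    show "x \<in> ?U \<inter> set p \<longleftrightarrow> x \<in> {p ! i | i. i \<le> path_length p \<and>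
        (i = 0 \<or> i = path_length p \<or> (odd i \<longleftrightarrow> p \<in> ?C))}"
      using alt_cover_nth[OF that] by (auto simp: in_path_iff[OF that])
  qed
  have rev: "rev p ! i = p ! (path_length p - i)" if "p \<in> \<P>" "i \<le> path_length p" for p i
    using length_path that by (simp add: rev_nth)
  have "melon_config G s t \<P> P\<^sub>e S\<^sub>o ?U"
    unfolding melon_config_def
  proof (intro conjI ballI alt_cover_subset)
    obtain m where m: "path_length P\<^sub>e = 2 * m" and p: "P\<^sub>e \<in> \<P>"
      using assms by (auto simp: even_paths_def)
    \<comment> \<open>The ends appear as indices \<open>0\<close> and \<open>2 * m\<close> so that
      both sides can be compared by index.\<close>
    have "?U \<inter> set P\<^sub>e = {P\<^sub>e ! (2 * j + 1) | j. j < m} \<union> {P\<^sub>e ! 0, P\<^sub>e ! (2 * m)}"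
      (is "_ = ?R")
    proof (intro equalityI subsetI)
      fix x assume "x \<in> ?U \<inter> set P\<^sub>e"
      then obtain i where i: "i \<le> 2 * m" "i = 0 \<or> i = 2 * m \<or> odd i" "x = P\<^sub>e ! i"
        unfolding U[OF p] m by blast
      show "x \<in> ?R"
      proof (cases "odd i")
        case True
        then obtain j where j: "i = 2 * j + 1" by (rule oddE)
        then have "j < m" using i(1) by simp
        then show ?thesis using i(3) j by blast
      qed (use i in auto)
    next
      fix x assume "x \<in> ?R"
      then show "x \<in> ?U \<inter> set P\<^sub>e" unfolding U[OF p] m by force
    qed
    then show "external s t ?U P\<^sub>e"
      unfolding external_def using m nth_path_first[OF p] nth_path_last[OF p] by auto
  next
    fix p assume p': "p \<in> even_paths \<P> - {P\<^sub>e}"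
    then obtain m where m: "path_length p = 2 * m" and p: "p \<in> \<P>"
      by (auto simp: even_paths_def)
    have "p \<notin> ?C" using p' by (auto simp: even_paths_def odd_paths_def)
    then have "?U \<inter> set p = {p ! (2 * j) | j. j \<le> m}"
      unfolding U[OF p] m by (auto elim!: evenE; force)
    then show "internal ?U p" unfolding internal_def using m by blast
  next
    fix p assume p': "p \<in> S\<^sub>o"
    then have "p \<in> odd_paths \<P>" using assms by blast
    then obtain m where m: "path_length p = 2 * m + 1" and p: "p \<in> \<P>"
      by (auto simp: odd_paths_def elim!: oddE)
    have "p \<notin> ?C" using p' assms by (auto simp: even_paths_def odd_paths_def)
    \<comment> \<open>The interior guards have even index. \<open>s\<close> has index
      \<open>0\<close> and fits this pattern; \<open>t\<close> has odd index
      \<open>2 * m + 1\<close> and is exactly the vertex removed.\<close>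
    then have "?U \<inter> set p - {t} = {p ! (2 * j) | j. j \<le> m}"
      (is "_ = ?R")
    proof (intro equalityI subsetI)
      fix x assume "x \<in> ?U \<inter> set p - {t}"
      then obtain i where i: "i \<le> path_length p" "x = p ! i"
          "i = 0 \<or> i = path_length p \<or> (odd i \<longleftrightarrow> p \<in> ?C)" and "x \<noteq> t"
        unfolding U[OF p] by blast
      then have "even i" "i \<noteq> path_length p" using \<open>p \<notin> ?C\<close> nth_path_last[OF p] by auto
      note i = i(1) this(2,1) i(2)
      from i(3) obtain j where "i = 2 * j" by (rule evenE)
      then show "x \<in> ?R" using i m by auto
    next
      fix x assume "x \<in> ?R"
      then obtain j where j: "j \<le> m" "x = p ! (2 * j)" by blast
      then have "x \<noteq> t" using nth_path_eq_t[OF p, of "2 * j"] m by auto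
      moreover have "x \<in> ?U \<inter> set p" using j m \<open>p \<notin> ?C\<close> unfolding U[OF p] by force
      ultimately show "x \<in> ?U \<inter> set p - {t}" by blast
    qed
    \<comment> \<open>Reindexing by \<open>m - j\<close>: position \<open>2 * j\<close> from
      \<open>s\<close> is position \<open>2 * (m - j) + 1\<close> from \<open>t\<close>.\<close>
    also have "\<dots> = {rev p ! (2 * i + 1) | i. i \<le> m}"
    proof (intro equalityI subsetI)
      fix x assume "x \<in> {p ! (2 * j) | j. j \<le> m}"
      then obtain j where "j \<le> m" "x = p ! (2 * j)" by blast
      then have "x = rev p ! (2 * (m - j) + 1)" "m - j \<le> m"
        using rev[OF p] m by (auto simp: diff_mult_distrib2)
      then show "x \<in> {rev p ! (2 * i + 1) | i. i \<le> m}" by blast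
    next
      fix x assume "x \<in> {rev p ! (2 * i + 1) | i. i \<le> m}"
      then obtain j where "j \<le> m" "x = rev p ! (2 * j + 1)" by blast
      then have "x = p ! (2 * (m - j))" "m - j \<le> m"
        using rev[OF p] m by (auto simp: diff_mult_distrib2)
      then show "x \<in> {p ! (2 * j) | j. j \<le> m}" by blast
    qed
    finally show "s_path t ?U p" unfolding s_path_def using m by blast
  next
    fix p assume p': "p \<in> odd_paths \<P> - S\<^sub>o"
    then obtain m where m: "path_length p = 2 * m + 1" and p: "p \<in> \<P>"
      by (auto simp: odd_paths_def elim!: oddE)
    have "p \<in> ?C" using p' by auto
    then have "?U \<inter> set p - {s} = {p ! (2 * j + 1) | j. j \<le> m}"
      (is "_ = ?R")
    proof (intro equalityI subsetI)
      fix x assume "x \<in> ?U \<inter> set p - {s}"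
      then obtain i where i: "i \<le> path_length p" "x = p ! i"
          "i = 0 \<or> i = path_length p \<or> (odd i \<longleftrightarrow> p \<in> ?C)" and "x \<noteq> s"
        unfolding U[OF p] by blast
      then have "odd i" using \<open>p \<in> ?C\<close> nth_path_first[OF p] m by auto
      note i = i(1) this i(2)
      from i(2) obtain j where "i = 2 * j + 1" by (rule oddE)
      then show "x \<in> ?R" using i m by auto
    next
      fix x assume "x \<in> ?R"
      then obtain j where j: "j \<le> m" "x = p ! (2 * j + 1)" by blast
      then have "x \<noteq> s" using nth_path_eq_s[OF p, of "2 * j + 1"] m by auto
      moreover have "x \<in> ?U \<inter> set p" using j m \<open>p \<in> ?C\<close> unfolding U[OF p] by force
      ultimately show "x \<in> ?U \<inter> set p - {s}" by blast
    qed
    also have "\<dots> = {rev p ! (2 * i) | i. i \<le> m}"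
    proof (intro equalityI subsetI)
      fix x assume "x \<in> {p ! (2 * j + 1) | j. j \<le> m}"
      then obtain j where "j \<le> m" "x = p ! (2 * j + 1)" by blast
      then have "x = rev p ! (2 * (m - j))" "m - j \<le> m"
        using rev[OF p] m by (auto simp: diff_mult_distrib2)
      then show "x \<in> {rev p ! (2 * i) | i. i \<le> m}" by blast
    next
      fix x assume "x \<in> {rev p ! (2 * i) | i. i \<le> m}"
      then obtain j where "j \<le> m" "x = rev p ! (2 * j)" by blast
      then have "x = p ! (2 * (m - j) + 1)" "m - j \<le> m"
        using rev[OF p] m by (auto simp: diff_mult_distrib2 Suc_diff_le)
      then show "x \<in> {p ! (2 * j + 1) | j. j \<le> m}" by blast
    qed
    finally show "t_path s ?U p" unfolding t_path_def using m by blast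
  qed
  \<comment> \<open>Configurations are unique, so the one exhibited is the set denoted by
    \<open>melon_set\<close>.\<close>
  then show ?thesis
    unfolding melon_set_def
    using melon_config_unique_existence[OF melon assms] by (rule the1_equality[rotated])
qed

subsection \<open>Defending an attack\<close>

text \<open>Equality of cardinalities turns surjectivity onto the target into injectivity.\<close>

lemma defenseI:
  assumes "card U = card U'" "finite U" "U' \<subseteq> verts G" "U' \<subseteq> \<phi> ` U"
    and "\<And>u. u \<in> U \<Longrightarrow> \<phi> u \<in> closed_nbhd G u"
    and "e = {v, w}" "v \<in> U" "\<phi> v = w"
  shows "defense G U e \<phi> \<and> \<phi> ` U = U'"
proof -
  have le: "card (\<phi> ` U) \<le> card U'" using card_image_le[OF assms(2)] assms(1) by simp
  then have im: "\<phi> ` U = U'"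
    using card_seteq[OF finite_imageI[OF assms(2)] assms(4)] by blast
  then have "inj_on \<phi> U" using assms(1,2) by (intro eq_card_imp_inj_on) auto
  moreover have "\<phi> ` U \<subseteq> verts G" using im assms(3) by (rule ord_eq_le_trans)
  moreover have "\<exists>v w. e = {v, w} \<and> v \<in> U \<and> \<phi> v = w" using assms(6-8) by (intro exI conjI)
  ultimately show ?thesis using im assms(5) by (simp add: defense_def)
qed

lemma finite_alt_cover: "finite (alt_cover C)"
  using finite_subset[OF alt_cover_subset finite_verts] .

text \<open>Recovers positions from vertices, so that guard moves can be defined on vertices. The
  value is meaningful only on the path, hence the membership tests in the maps below.\<close>

definition index :: "'a list \<Rightarrow> 'a \<Rightarrow> nat" where
  "index p x = (THE i. i \<le> path_length p \<and> p ! i = x)"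

lemma index_nth: "p \<in> \<P> \<Longrightarrow> i \<le> path_length p \<Longrightarrow> index p (p ! i) = i"
  unfolding index_def using nth_path_inj[of p] by (intro the_equality) auto

lemma nbhd_Suc: "p \<in> \<P> \<Longrightarrow> i < path_length p \<Longrightarrow> p ! Suc i \<in> closed_nbhd G (p ! i)"
  using edge_in_graph[of p i] nth_in_verts[of p "Suc i"] by (auto simp: closed_nbhd_def)

lemma nbhd_pred: "p \<in> \<P> \<Longrightarrow> i < path_length p \<Longrightarrow> p ! i \<in> closed_nbhd G (p ! Suc i)"
  using edge_in_graph[of p i] nth_in_verts[of p i] by (auto simp: closed_nbhd_def insert_commute)

text \<open>Guards at odd indices of \<open>p\<close> step towards \<open>s\<close>, guards at even
  indices of \<open>q\<close> step towards \<open>t\<close>. The guard of \<open>s\<close> leaves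
  along \<open>q\<close> and is replaced from \<open>p ! 1\<close>. For even lengths
  \<open>t\<close> keeps its guard; for odd lengths that guard leaves along \<open>p\<close> and is
  replaced from \<open>q\<close>.\<close>

lemma exchange_defense_even_edge:
  assumes p: "p \<in> \<P>" "p \<in> C" and q: "q \<in> \<P>" "q \<notin> C"
    and par: "even (path_length p) \<longleftrightarrow> even (path_length q)"
    and card: "card (alt_cover C) = card (alt_cover (insert q (C - {p})))"
    and e: "(\<exists>i < path_length p. even i \<and> e = {p ! i, p ! Suc i}) \<or>
      (\<exists>i < path_length q. even i \<and> e = {q ! i, q ! Suc i})"
  shows "\<exists>\<phi>. defense G (alt_cover C) e \<phi> \<and> \<phi> ` alt_cover C = alt_cover (insert q (C - {p}))"
proof -
  let ?U = "alt_cover C" and ?C' = "insert q (C - {p})"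
  have pq: "p \<noteq> q" using p q by auto
  define \<phi> where "\<phi> x = (if x \<in> set p \<and> odd (index p x) then p ! (index p x - 1)
    else if x \<in> set q \<and> even (index q x) \<and> index q x < path_length q then q ! Suc (index q x)
    else x)" for x
  have \<phi>p: "\<phi> (p ! Suc i) = p ! i" if "even i" "i < path_length p" for i
    using that p by (simp add: \<phi>_def index_nth nth_in_path)
  \<comment> \<open>The branch for \<open>p\<close> comes first in \<open>\<phi>\<close>, so it must
    not capture a moving vertex of \<open>q\<close>. The only possible shared one is
    \<open>s\<close>, whose index on \<open>p\<close> is even.\<close>
  have not_p: "\<not> (q ! i \<in> set p \<and> odd (index p (q ! i)))" if "even i" "i < path_length q" for i
  proof (cases "i = 0")
    case True
    then show ?thesis
      using nth_path_first[OF q(1)] nth_path_first[OF p(1)] index_nth[OF p(1), of 0] by simp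
  next
    case False
    then show ?thesis
      using nth_paths_eq[OF q(1) p(1)] that pq in_path_iff[OF p(1)] by blast
  qed
  have \<phi>q: "\<phi> (q ! i) = q ! Suc i" if "even i" "i < path_length q" for i
    using not_p[OF that] that q by (auto simp: \<phi>_def index_nth nth_in_path)
  have \<phi>t: "\<phi> t = t" if "even (path_length p)"
    using that nth_path_last[OF p(1)] nth_path_last[OF q(1)] index_nth[OF p(1) order_refl]
      index_nth[OF q(1) order_refl] by (simp add: \<phi>_def)
  \<comment> \<open>By \<open>defenseI\<close> it suffices to find a preimage of every target
    vertex: the successor on \<open>p\<close>, the predecessor on \<open>q\<close>, the vertex
    itself elsewhere.\<close>
  have reach: "x \<in> \<phi> ` ?U" if "x \<in> alt_cover ?C'" for x
  proof -
    from that show ?thesis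
    proof (cases rule: alt_cover_cases)
      case 1
      have "p ! 1 \<in> ?U" using alt_cover_nth[OF p(1), of 1] p path_length_pos[OF p(1)] by simp
      then show ?thesis
        using 1 \<phi>p[of 0] path_length_pos[OF p(1)] nth_path_first[OF p(1)] by force
    next
      case 2
      show ?thesis
      proof (cases "even (path_length p)")
        case True
        then show ?thesis using 2 \<phi>t by (force simp: alt_cover_def)
      next
        case False
        define i where "i = path_length q - 1"
        have i: "even i" "i < path_length q" "Suc i = path_length q"
          using False par path_length_pos[OF q(1)] by (auto simp: i_def)
        have "q ! i \<in> ?U" using alt_cover_nth[OF q(1), of i] i q by simp
        then show ?thesis using 2 \<phi>q[OF i(1,2)] i(3) nth_path_last[OF q(1)] by (metis imageI)
      qed
    next
      case (3 r i)
      consider "r = p" | "r = q" | "r \<noteq> p" "r \<noteq> q" by blast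
      then show ?thesis
      proof cases
        case 1
        then have i: "even i" "i < path_length p" using 3 pq by auto
        then have "p ! Suc i \<in> ?U" using alt_cover_nth[OF p(1), of "Suc i"] p by simp
        then show ?thesis using \<phi>p[OF i] 3 1 by (metis imageI)
      next
        case 2
        then obtain j where j: "i = Suc j" "even j" "j < path_length q" using 3 by (cases i) auto
        then have "q ! j \<in> ?U" using alt_cover_nth[OF q(1), of j] q by simp
        then show ?thesis using \<phi>q[OF j(2,3)] 3 2 j(1) by (metis imageI)
      next
        case other: 3
        have "x \<notin> set p" "x \<notin> set q"
          using nth_paths_eq[OF 3(1)] 3 other in_path_iff p(1) q(1) by metis+
        then have "\<phi> x = x" by (simp add: \<phi>_def)
        moreover have "x \<in> ?U" using alt_cover_nth[of r i] 3 other by simp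
        ultimately show ?thesis by (metis imageI)
      qed
    qed
  qed
  have nbhd: "\<phi> u \<in> closed_nbhd G u" for u
  proof -
    consider i where "i < path_length p" "even i" "u = p ! Suc i"
      | i where "i < path_length q" "even i" "u = q ! i" | "\<phi> u = u"
    proof (cases "u \<in> set p \<and> odd (index p u)")
      case True
      then obtain j where j: "j \<le> path_length p" "u = p ! j" using in_path_iff[OF p(1)] by blast
      then obtain i where "j = Suc i" "even i" using True index_nth[OF p(1)] by (cases j) auto
      then show ?thesis using that(1)[of i] j by auto
    next
      case False
      show ?thesis
      proof (cases "u \<in> set q \<and> even (index q u) \<and> index q u < path_length q")
        case True
        then obtain i where "i \<le> path_length q" "u = q ! i" using in_path_iff[OF q(1)] by blast
        then show ?thesis using that(2) True index_nth[OF q(1)] by auto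
      qed (use False that(3) in \<open>auto simp: \<phi>_def\<close>)
    qed
    then show ?thesis
      by cases (use \<phi>p \<phi>q nbhd_Suc nbhd_pred p q in \<open>auto simp: closed_nbhd_def[of _ u]\<close>)
  qed
  have "\<exists>v w. e = {v, w} \<and> v \<in> ?U \<and> \<phi> v = w"
    using e
  proof
    assume "\<exists>i < path_length p. even i \<and> e = {p ! i, p ! Suc i}"
    then obtain i where i: "i < path_length p" "even i" "e = {p ! Suc i, p ! i}" by blast
    then have "p ! Suc i \<in> ?U" using alt_cover_nth[OF p(1), of "Suc i"] p by simp
    then show ?thesis using i \<phi>p by blast
  next
    assume "\<exists>i < path_length q. even i \<and> e = {q ! i, q ! Suc i}"
    then obtain i where i: "i < path_length q" "even i" "e = {q ! i, q ! Suc i}" by blast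
    then have "q ! i \<in> ?U" using alt_cover_nth[OF q(1), of i] q by simp
    then show ?thesis using i \<phi>q by blast
  qed
  then show ?thesis
    using defenseI[OF card finite_alt_cover alt_cover_subset] reach nbhd by blast
qed

text \<open>The same exchange in the opposite directions: \<open>p\<close> moves towards
  \<open>t\<close> and \<open>q\<close> towards \<open>s\<close>. Now \<open>s\<close> always keeps
  its guard. For odd lengths \<open>t\<close> does too; for even lengths its guard leaves along
  \<open>q\<close> and is replaced from \<open>p\<close>.\<close>

lemma exchange_defense_odd_edge:
  assumes p: "p \<in> \<P>" "p \<in> C" and q: "q \<in> \<P>" "q \<notin> C"
    and par: "even (path_length p) \<longleftrightarrow> even (path_length q)"
    and card: "card (alt_cover C) = card (alt_cover (insert q (C - {p})))"
    and e: "(\<exists>i < path_length p. odd i \<and> e = {p ! i, p ! Suc i}) \<or>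
      (\<exists>i < path_length q. odd i \<and> e = {q ! i, q ! Suc i})"
  shows "\<exists>\<phi>. defense G (alt_cover C) e \<phi> \<and> \<phi> ` alt_cover C = alt_cover (insert q (C - {p}))"
proof -
  let ?U = "alt_cover C" and ?C' = "insert q (C - {p})"
  have pq: "p \<noteq> q" using p q by auto
  define \<phi> where "\<phi> x = (if x \<in> set p \<and> odd (index p x) \<and> index p x < path_length p
      then p ! Suc (index p x)
    else if x \<in> set q \<and> even (index q x) \<and> 0 < index q x then q ! (index q x - 1)
    else x)" for x
  have \<phi>p: "\<phi> (p ! i) = p ! Suc i" if "odd i" "i < path_length p" for i
    using that p by (simp add: \<phi>_def index_nth nth_in_path)
  \<comment> \<open>Here the only possible shared vertex is \<open>t\<close>, which the bound on the
    index in the branch for \<open>p\<close> excludes.\<close>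
  have not_p: "\<not> (q ! Suc i \<in> set p \<and> odd (index p (q ! Suc i)) \<and> index p (q ! Suc i) < path_length p)"
    if "odd i" "i < path_length q" for i
  proof (cases "Suc i = path_length q")
    case True
    then show ?thesis
      using nth_path_last[OF q(1)] nth_path_last[OF p(1)] index_nth[OF p(1) order_refl] by simp
  next
    case False
    then show ?thesis
      using nth_paths_eq[OF q(1) p(1), of "Suc i"] that pq in_path_iff[OF p(1)]
      by (metis Suc_lessI zero_less_Suc)
  qed
  have \<phi>q: "\<phi> (q ! Suc i) = q ! i" if "odd i" "i < path_length q" for i
    using not_p[OF that] that q by (auto simp: \<phi>_def index_nth nth_in_path)
  have \<phi>s: "\<phi> s = s"
    using nth_path_first[OF p(1)] nth_path_first[OF q(1)] index_nth[OF p(1), of 0]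
      index_nth[OF q(1), of 0] by (simp add: \<phi>_def)
  have \<phi>t: "\<phi> t = t" if "odd (path_length p)"
    using that par nth_path_last[OF p(1)] nth_path_last[OF q(1)] index_nth[OF p(1) order_refl]
      index_nth[OF q(1) order_refl] by (simp add: \<phi>_def)
  have reach: "x \<in> \<phi> ` ?U" if "x \<in> alt_cover ?C'" for x
  proof -
    from that show ?thesis
    proof (cases rule: alt_cover_cases)
      case 1
      then show ?thesis using \<phi>s by (force simp: alt_cover_def)
    next
      case 2
      show ?thesis
      proof (cases "odd (path_length p)")
        case True
        then show ?thesis using 2 \<phi>t by (force simp: alt_cover_def)
      next
        case False
        define i where "i = path_length p - 1"
        have i: "odd i" "i < path_length p" "Suc i = path_length p"
          using False path_length_pos[OF p(1)] by (auto simp: i_def)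
        have "p ! i \<in> ?U" using alt_cover_nth[OF p(1), of i] i p by simp
        then show ?thesis using 2 \<phi>p[OF i(1,2)] i(3) nth_path_last[OF p(1)] by (metis imageI)
      qed
    next
      case (3 r i)
      consider "r = p" | "r = q" | "r \<noteq> p" "r \<noteq> q" by blast
      then show ?thesis
      proof cases
        case 1
        then obtain j where j: "i = Suc j" "odd j" "j < path_length p" using 3 pq by (cases i) auto
        then have "p ! j \<in> ?U" using alt_cover_nth[OF p(1), of j] p by simp
        then show ?thesis using \<phi>p[OF j(2,3)] 3 1 j(1) by (metis imageI)
      next
        case 2
        then have i: "odd i" "i < path_length q" using 3 by auto
        then have "q ! Suc i \<in> ?U" using alt_cover_nth[OF q(1), of "Suc i"] q by simp
        then show ?thesis using \<phi>q[OF i] 3 2 by (metis imageI)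
      next
        case other: 3
        have "x \<notin> set p" "x \<notin> set q"
          using nth_paths_eq[OF 3(1)] 3 other in_path_iff p(1) q(1) by metis+
        then have "\<phi> x = x" by (simp add: \<phi>_def)
        moreover have "x \<in> ?U" using alt_cover_nth[of r i] 3 other by simp
        ultimately show ?thesis by (metis imageI)
      qed
    qed
  qed
  have nbhd: "\<phi> u \<in> closed_nbhd G u" for u
  proof -
    consider i where "i < path_length p" "odd i" "u = p ! i"
      | i where "i < path_length q" "odd i" "u = q ! Suc i" | "\<phi> u = u"
    proof (cases "u \<in> set p \<and> odd (index p u) \<and> index p u < path_length p")
      case True
      then obtain i where "i \<le> path_length p" "u = p ! i" using in_path_iff[OF p(1)] by blast
      then show ?thesis using that(1) True index_nth[OF p(1)] by auto
    next
      case False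
      show ?thesis
      proof (cases "u \<in> set q \<and> even (index q u) \<and> 0 < index q u")
        case True
        then obtain j where j: "j \<le> path_length q" "u = q ! j" using in_path_iff[OF q(1)] by blast
        then obtain i where "j = Suc i" "odd i" using True index_nth[OF q(1)] by (cases j) auto
        then show ?thesis using that(2)[of i] j by auto
      qed (use False that(3) in \<open>auto simp: \<phi>_def\<close>)
    qed
    then show ?thesis
      by cases (use \<phi>p \<phi>q nbhd_Suc nbhd_pred p q in \<open>auto simp: closed_nbhd_def[of _ u]\<close>)
  qed
  have "\<exists>v w. e = {v, w} \<and> v \<in> ?U \<and> \<phi> v = w"
    using e
  proof
    assume "\<exists>i < path_length p. odd i \<and> e = {p ! i, p ! Suc i}"
    then obtain i where i: "i < path_length p" "odd i" "e = {p ! i, p ! Suc i}" by blast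
    then have "p ! i \<in> ?U" using alt_cover_nth[OF p(1), of i] p by simp
    then show ?thesis using i \<phi>p by blast
  next
    assume "\<exists>i < path_length q. odd i \<and> e = {q ! i, q ! Suc i}"
    then obtain i where i: "i < path_length q" "odd i" "e = {q ! Suc i, q ! i}" by blast
    then have "q ! Suc i \<in> ?U" using alt_cover_nth[OF q(1), of "Suc i"] q by simp
    then show ?thesis using i \<phi>q by blast
  qed
  then show ?thesis
    using defenseI[OF card finite_alt_cover alt_cover_subset] reach nbhd by blast
qed

lemma exchange_defense:
  assumes "p \<in> \<P>" "p \<in> C" "q \<in> \<P>" "q \<notin> C"
    and "even (path_length p) \<longleftrightarrow> even (path_length q)"
    and "r = p \<or> r = q" "i < path_length r"
  shows "\<exists>\<phi>. defense G (alt_cover C) {r ! i, r ! Suc i} \<phi> \<and>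
    \<phi> ` alt_cover C = alt_cover (insert q (C - {p}))"
proof -
  let ?C' = "insert q (C - {p})" and ?E = "even_paths \<P>"
  \<comment> \<open>An exchange within one parity class preserves the number of even paths in the
    state, and by \<open>card_alt_cover\<close> nothing else affects the size.\<close>
  have "card (?E \<inter> ?C') = card (?E \<inter> C)"
  proof (cases "even (path_length p)")
    case True
    then have "?E \<inter> ?C' = insert q (?E \<inter> C - {p})" "p \<in> ?E \<inter> C"
      using assms by (auto simp: even_paths_def)
    then show ?thesis using assms(4) finite_even
      by (metis Diff_iff Int_iff card.remove card_insert_disjoint finite_Diff finite_Int)
  next
    case False
    then have "?E \<inter> ?C' = ?E \<inter> C" using assms(5) by (auto simp: even_paths_def)
    then show ?thesis by simp
  qed
  then have "card (alt_cover C) = card (alt_cover ?C')"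
    using card_alt_cover[of C] card_alt_cover[of ?C'] by simp
  then show ?thesis
    using exchange_defense_even_edge[OF assms(1-5)] exchange_defense_odd_edge[OF assms(1-5)] assms(6,7)
    by (cases "even i") blast+
qed

section \<open>States of the class and exchanges between them\<close>

text \<open>The class encoded by the parameter \<open>C\<close> of \<open>alt_cover\<close>, so that
  answering an attack becomes swapping one path of \<open>C\<close> for one outside.\<close>

definition valid_states :: "'a list set set" where
  "valid_states = {insert P\<^sub>e (odd_paths \<P> - S\<^sub>o) | P\<^sub>e S\<^sub>o.
     P\<^sub>e \<in> even_paths \<P> \<and> S\<^sub>o \<noteq> {} \<and> S\<^sub>o \<subset> odd_paths \<P>}"

lemma melon_class_eq: "melon_class G s t \<P> = alt_cover ` valid_states"
proof (intro equalityI subsetI)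
  fix U assume "U \<in> melon_class G s t \<P>"
  then obtain P\<^sub>e S\<^sub>o where "U = melon_set G s t \<P> P\<^sub>e S\<^sub>o" "P\<^sub>e \<in> even_paths \<P>" "S\<^sub>o \<noteq> {}"
      "S\<^sub>o \<subset> odd_paths \<P>"
    unfolding melon_class_def by blast
  then have "U = alt_cover (insert P\<^sub>e (odd_paths \<P> - S\<^sub>o))"
      "insert P\<^sub>e (odd_paths \<P> - S\<^sub>o) \<in> valid_states"
    using melon_set_eq_alt_cover[of P\<^sub>e S\<^sub>o] unfolding valid_states_def by blast+
  then show "U \<in> alt_cover ` valid_states" by blast
next
  fix U assume "U \<in> alt_cover ` valid_states"
  then obtain P\<^sub>e S\<^sub>o where "U = alt_cover (insert P\<^sub>e (odd_paths \<P> - S\<^sub>o))"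
      "P\<^sub>e \<in> even_paths \<P>" "S\<^sub>o \<noteq> {}" "S\<^sub>o \<subset> odd_paths \<P>"
    unfolding valid_states_def by blast
  moreover from this have "U = melon_set G s t \<P> P\<^sub>e S\<^sub>o"
    using melon_set_eq_alt_cover[of P\<^sub>e S\<^sub>o] by blast
  ultimately show "U \<in> melon_class G s t \<P>" unfolding melon_class_def by blast
qed

lemma valid_state_exchange:
  assumes C: "C \<in> valid_states" and r: "r \<in> \<P>" and two: "card (even_paths \<P>) \<ge> 2"
  obtains p q where "p \<in> \<P>" "p \<in> C" "q \<in> \<P>" "q \<notin> C"
    "even (path_length p) \<longleftrightarrow> even (path_length q)" "r = p \<or> r = q"
    "insert q (C - {p}) \<in> valid_states"
proof -
  obtain P\<^sub>e S\<^sub>o where CC: "C = insert P\<^sub>e (odd_paths \<P> - S\<^sub>o)" "P\<^sub>e \<in> even_paths \<P>" "S\<^sub>o \<noteq> {}"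
      "S\<^sub>o \<subset> odd_paths \<P>"
    using C by (auto simp: valid_states_def)
  have Pe: "P\<^sub>e \<in> \<P>" "even (path_length P\<^sub>e)" "P\<^sub>e \<notin> odd_paths \<P>"
    using CC(2) by (auto simp: even_paths_def odd_paths_def)
  show ?thesis
  proof (cases "even (path_length r)")
    case True
    \<comment> \<open>\<open>P\<^sub>e\<close> is the only even path in \<open>C\<close>, so it must
      be \<open>p\<close>. The partner \<open>q\<close> is \<open>r\<close> itself, or any second
      even path if \<open>r\<close> is \<open>P\<^sub>e\<close>.\<close>
    have "\<not> even_paths \<P> \<subseteq> {P\<^sub>e}" using two card_mono[of "{P\<^sub>e}" "even_paths \<P>"] by auto
    then obtain q where q: "q \<in> even_paths \<P>" "q \<noteq> P\<^sub>e" "r = P\<^sub>e \<or> r = q"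
      using True r by (cases "r = P\<^sub>e") (auto simp: even_paths_def)
    then have q': "q \<in> \<P>" "even (path_length q)" "q \<notin> odd_paths \<P>"
      by (auto simp: even_paths_def odd_paths_def)
    have "insert q (C - {P\<^sub>e}) = insert q (odd_paths \<P> - S\<^sub>o)" using CC(1) Pe(3) by auto
    then have "insert q (C - {P\<^sub>e}) \<in> valid_states"
      unfolding valid_states_def using CC q(1) by blast
    then show ?thesis using that[of P\<^sub>e q] CC(1) Pe q q' by auto
  next
    case False
    then have r_odd: "r \<in> odd_paths \<P>" using r by (auto simp: odd_paths_def)
    obtain p q where pq: "p \<in> odd_paths \<P> - S\<^sub>o" "q \<in> S\<^sub>o" "r = p \<or> r = q"
      using r_odd CC(3,4) by (cases "r \<in> S\<^sub>o") blast+
    have pq': "p \<in> \<P>" "odd (path_length p)" "q \<in> \<P>" "odd (path_length q)" "q \<in> odd_paths \<P>"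
      using pq CC(4) by (auto simp: odd_paths_def)
    \<comment> \<open>After the swap the new set of \<open>s\<close>-paths contains \<open>p\<close>
      and misses \<open>q\<close>, so it is again nonempty and proper.\<close>
    let ?S = "insert p (S\<^sub>o - {q})"
    have "insert q (C - {p}) = insert P\<^sub>e (odd_paths \<P> - ?S)"
      using CC pq pq' Pe by auto
    moreover have "?S \<noteq> {}" "?S \<subset> odd_paths \<P>" using pq CC(4) pq' by auto
    ultimately have "insert q (C - {p}) \<in> valid_states"
      unfolding valid_states_def using CC(2) by blast
    moreover have "p \<in> C" "q \<notin> C" using CC(1) pq Pe pq' by auto
    ultimately show ?thesis using that[of p q] pq pq' by auto
  qed
qed

lemma card_valid_state:
  assumes "C \<in> valid_states"
  shows "card (alt_cover C) + card (even_paths \<P>) = half_sum + 3"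
proof -
  obtain P\<^sub>e where "even_paths \<P> \<inter> C = {P\<^sub>e}"
    using assms by (auto simp: valid_states_def even_paths_def odd_paths_def)
  then show ?thesis using card_alt_cover[of C] by simp
qed

section \<open>The values of \<open>vc\<close> and \<open>evc\<close>\<close>

context
  assumes even2: "card (even_paths \<P>) \<ge> 2" and odd2: "card (odd_paths \<P>) \<ge> 2"
begin

lemma odd_nonempty: "odd_paths \<P> \<noteq> {}"
  using odd2 by auto

text \<open>The lower bound is attained by \<open>C = {}\<close>, where every even path is internal
  and every odd path is an \<open>s\<close>-path.\<close>

lemma vc_eq: "vc G + card (even_paths \<P>) = half_sum + 2"
proof -
  have "vc G = card (alt_cover {})"
    unfolding vc_def
  proof (rule Least_equality)
    show "\<exists>U. vertex_cover G U \<and> card U = card (alt_cover {})"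
      using vertex_cover_alt_cover by blast
  next
    fix n assume "\<exists>U. vertex_cover G U \<and> card U = n"
    then obtain U where "vertex_cover G U" "card U = n" by blast
    then show "card (alt_cover {}) \<le> n"
      using cover_card_lower[OF _ even2 odd_nonempty, of U] card_alt_cover[of "{}"] by simp
  qed
  then show ?thesis using card_alt_cover[of "{}"] by simp
qed

lemma eternal_melon_class: "eternal_vc_class G (vc G + 1) (melon_class G s t \<P>)"
  unfolding eternal_vc_class_def melon_class_eq
proof (intro conjI ballI)
  obtain P\<^sub>e where "P\<^sub>e \<in> even_paths \<P>" using even2 by fastforce
  moreover obtain p where "p \<in> odd_paths \<P>" using odd_nonempty by blast
  \<comment> \<open>With two odd paths a singleton is a proper nonempty choice of
    \<open>s\<close>-paths, so the class is not empty.\<close>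
  moreover have "card {p} \<noteq> card (odd_paths \<P>)" using odd2 by simp
  then have "{p} \<noteq> odd_paths \<P>" by metis
  ultimately have "insert P\<^sub>e (odd_paths \<P> - {p}) \<in> valid_states"
    unfolding valid_states_def by blast
  then show "alt_cover ` valid_states \<noteq> {}" by blast
next
  fix U assume "U \<in> alt_cover ` valid_states"
  then obtain C where C: "C \<in> valid_states" "U = alt_cover C" by blast
  show "vertex_cover G U" using C vertex_cover_alt_cover by simp
  show "card U = vc G + 1" using C card_valid_state vc_eq by force
  fix e assume "e \<in> edges G"
  then obtain r i where r: "r \<in> \<P>" "i < path_length r" "e = {r ! i, r ! Suc i}"
    by (rule edge_cases)
  obtain p q where pq: "p \<in> \<P>" "p \<in> C" "q \<in> \<P>" "q \<notin> C"
    "even (path_length p) \<longleftrightarrow> even (path_length q)" "r = p \<or> r = q"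
    "insert q (C - {p}) \<in> valid_states"
    using valid_state_exchange[OF C(1) r(1) even2] by blast
  show "\<exists>\<phi>. defense G U e \<phi> \<and> \<phi> ` U \<in> alt_cover ` valid_states"
    using exchange_defense[OF pq(1-6) r(2)] pq(7) C(2) r(3) by fastforce
qed

lemma eternal_class_size:
  assumes "eternal_vc_class G n \<U>"
  shows "vc G + 1 \<le> n"
proof -
  obtain U where U: "U \<in> \<U>" using assms by (auto simp: eternal_vc_class_def)
  obtain p where p: "p \<in> even_paths \<P>" using even2 by fastforce
  then have pP: "p \<in> \<P>" by (simp add: even_paths_def)
  have "{p ! 0, p ! 1} \<in> edges G"
    using edge_in_graph[OF pP path_length_pos[OF pP]] by simp
  then obtain \<phi> where \<phi>: "defense G U {p ! 0, p ! 1} \<phi>" "\<phi> ` U \<in> \<U>"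
    using assms U unfolding eternal_vc_class_def by blast
  then obtain v w where "{p ! 0, p ! 1} = {v, w}" "v \<in> U" "\<phi> v = w"
    by (auto simp: defense_def)
  \<comment> \<open>The defending guard crosses the attacked edge, so \<open>p ! 1\<close> is
    occupied either before or after the move, and both covers belong to the class.\<close>
  then have "p ! 1 \<in> U \<or> p ! 1 \<in> \<phi> ` U" by (metis doubleton_eq_iff imageI)
  then obtain W where W: "W \<in> \<U>" "p ! 1 \<in> W" using U \<phi>(2) by blast
  then have "vertex_cover G W" "card W = n" using assms by (auto simp: eternal_vc_class_def)
  then show ?thesis
    using cover_card_lower_strict[OF _ even2 odd_nonempty p W(2)] vc_eq by simp
qed

lemma evc_eq: "evc G = vc G + 1"
  unfolding evc_def
proof (rule Least_equality)
  show "\<exists>\<U>. eternal_vc_class G (vc G + 1) \<U>" using eternal_melon_class by (rule exI)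
  show "vc G + 1 \<le> n" if "\<exists>\<U>. eternal_vc_class G n \<U>" for n
    using that by (elim exE) (rule eternal_class_size)
qed

end

end

theorem theorem13:
  fixes G :: "'a ugraph" and s t :: 'a and \<P> :: "'a list set" and k :: nat
  assumes "k \<ge> 4"
    and "melon_graph k G s t \<P>"
    and "mixed \<P>"
    and "card (even_paths \<P>) \<ge> 2"
    and "card (odd_paths \<P>) \<ge> 2"
  shows "evc G = vc G + 1 \<and> minimum_eternal_vc_class G (melon_class G s t \<P>)"
proof -
  interpret melon k G s t \<P> by unfold_locales (rule assms(2))
  show ?thesis
    using evc_eq[OF assms(4,5)] eternal_melon_class[OF assms(4,5)]
    by (simp add: minimum_eternal_vc_class_def)
qed

end
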